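(* Let $(M^n,g)$, $n>3$, be a nearly quasi-Einstein manifold $N(QE)_n$, and let $l,m$ be nowhere vanishing scalar functions on $M$. If $(M,g)$ is semiconformally flat, i.e. $\tilde C(X,Y,Z,W)=0$ for all vector fields $X,Y,Z,W$, where $\tilde C$ is the semiconformal curvature tensor formed with $l,m$, then $(M,g)$ is a manifold of nearly quasi-constant curvature $N(QC)_n$.
   Context: Let $(M^n,g)$ be a semi-Riemannian manifold with Riemann curvature $R(X,Y)Z$, $\tilde R(X,Y,Z,W)=g(R(X,Y)Z,W)$, Ricci tensor $S$ and scalar curvature $r$. The sign convention is the one in which constant curvature $c$ means $R(X,Y)Z=c[g(Y,Z)X-g(X,Z)Y]$, and $S(Y,Z)=\mathrm{trace}(X\mapsto R(X,Y)Z)$. A non-flat semi-Riemannian manifold $(M^n,g)$, $n\ge 3$, is a nearly quasi-Einstein manifold, denoted $N(QE)_n$, if $S(X,Y)=\alpha g(X,Y)+\beta D(X,Y)$ for scalar functions $\alpha,\beta$ with $\beta\neq0$ and a nonzero symmetric $(0,2)$ tensor $D$. The conformal and conharmonic curvature tensors are $$C(X,Y,Z,W)=\tilde R(X,Y,Z,W)-\tfrac{1}{n-2}[S(Y,Z)g(X,W)-S(X,Z)g(Y,W)+g(Y,Z)S(X,W)-g(X,Z)S(Y,W)]+\tfrac{r}{(n-1)(n-2)}[g(Y,Z)g(X,W)-g(X,Z)g(Y,W)],$$ $$H(X,Y,Z,W)=\tilde R(X,Y,Z,W)-\tfrac{1}{n-2}[g(X,W)S(Y,Z)-g(X,Z)S(Y,W)+g(Y,Z)S(X,W)-g(Y,W)S(X,Z)].$$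 The semiconformal curvature tensor (for nonzero scalar functions $l,m$) is $\tilde C=-(n-2)m\,C+[l+(n-2)m]H$. $(M,g)$ is a manifold of nearly quasi-constant curvature, denoted $N(QC)_n$, if there are scalar functions $a,b$ and a nonzero symmetric $(0,2)$ tensor $E$ with $$\tilde R(X,Y,Z,W)=a[g(Y,Z)g(X,W)-g(X,Z)g(Y,W)]+b[g(X,W)E(Y,Z)-g(X,Z)E(Y,W)+g(Y,Z)E(X,W)-g(Y,W)E(X,Z)].$$ *)

theory Defs
  imports "HOL-Analysis.Analysis" "HOL-Library.Function_Algebras"
begin

section \<open>Smooth manifolds\<close>

definition partial :: "'n::finite \<Rightarrow> (real^'n \<Rightarrow> real) \<Rightarrow> real^'n \<Rightarrow> real" where
  "partial i f x = frechet_derivative f (at x) (axis i 1)"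

text \<open>The classes \<open>C\<^sup>k\<close> and \<open>C\<^sup>\<infinity>\<close>; the set is meant to be open.\<close>

primrec Ck_on :: "nat \<Rightarrow> (real^'n::finite) set \<Rightarrow> (real^'n \<Rightarrow> real) \<Rightarrow> bool" where
  "Ck_on 0 U f \<longleftrightarrow> continuous_on U f"
| "Ck_on (Suc k) U f \<longleftrightarrow>
     (\<forall>x\<in>U. f differentiable (at x)) \<and> (\<forall>i. Ck_on k U (partial i f))"

definition smooth_on :: "(real^'n::finite) set \<Rightarrow> (real^'n \<Rightarrow> real) \<Rightarrow> bool" where
  "smooth_on U f \<longleftrightarrow> (\<forall>k. Ck_on k U f)"

text \<open>The manifold \<open>M\<close> is the whole type \<open>'a\<close>, and its dimension is \<open>CARD('n)\<close>. A chart is a pair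
  \<open>(U, \<phi>)\<close>. The atlas need not be maximal: all notions below depend only on the smooth
  structure that it generates.\<close>

type_synonym ('a, 'n) atlas = "('a set \<times> ('a \<Rightarrow> real^'n)) set"

definition smooth_atlas ::
    "('a::{t2_space,second_countable_topology}, 'n::finite) atlas \<Rightarrow> bool" where
  "smooth_atlas A \<longleftrightarrow>
     (\<forall>(U, \<phi>)\<in>A. open U \<and> open (\<phi> ` U) \<and> homeomorphism U (\<phi> ` U) \<phi> (inv_into U \<phi>)) \<and>
     (\<Union>(U, \<phi>)\<in>A. U) = UNIV \<and>
     (\<forall>(U, \<phi>)\<in>A. \<forall>(V, \<psi>)\<in>A. \<forall>i. smooth_on (\<phi> ` (U \<inter> V)) (\<lambda>x. \<psi> (inv_into U \<phi> x) $ i))"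

definition smooth_funs :: "('a, 'n::finite) atlas \<Rightarrow> ('a \<Rightarrow> real) set" where
  "smooth_funs A = {f. \<forall>(U, \<phi>)\<in>A. smooth_on (\<phi> ` U) (\<lambda>x. f (inv_into U \<phi> x))}"


section \<open>Tangent vectors and vector fields\<close>

text \<open>A tangent vector at \<open>p\<close> is a derivation at \<open>p\<close> of the algebra of smooth functions on \<open>M\<close>,
  made total by the value 0 on functions that are not smooth.
  Sums and differences of tangent vectors and of vector fields are the pointwise ones.\<close>

type_synonym 'a tvec = "('a \<Rightarrow> real) \<Rightarrow> real"
type_synonym 'a vfield = "'a \<Rightarrow> 'a tvec"
type_synonym 'a tensor2 = "'a \<Rightarrow> 'a tvec \<Rightarrow> 'a tvec \<Rightarrow> real"

definition tv_scale :: "real \<Rightarrow> 'a tvec \<Rightarrow> 'a tvec" where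
  "tv_scale c v = (\<lambda>f. c * v f)"

global_interpretation tv: vector_space "tv_scale :: real \<Rightarrow> 'a tvec \<Rightarrow> 'a tvec"
  by unfold_locales (auto simp: tv_scale_def fun_eq_iff algebra_simps)

definition tangent_space :: "('a, 'n::finite) atlas \<Rightarrow> 'a \<Rightarrow> 'a tvec set" where
  "tangent_space A p = {v.
     (\<forall>f. f \<notin> smooth_funs A \<longrightarrow> v f = 0) \<and>
     (\<forall>f\<in>smooth_funs A. \<forall>h\<in>smooth_funs A. v (\<lambda>q. f q + h q) = v f + v h) \<and>
     (\<forall>c. \<forall>f\<in>smooth_funs A. v (\<lambda>q. c * f q) = c * v f) \<and>
     (\<forall>f\<in>smooth_funs A. \<forall>h\<in>smooth_funs A. v (\<lambda>q. f q * h q) = v f * h p + f p * v h)}"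

definition vector_fields :: "('a, 'n::finite) atlas \<Rightarrow> 'a vfield set" where
  "vector_fields A = {X. (\<forall>p. X p \<in> tangent_space A p) \<and>
     (\<forall>f\<in>smooth_funs A. (\<lambda>p. X p f) \<in> smooth_funs A)}"

definition vf_scale :: "('a \<Rightarrow> real) \<Rightarrow> 'a vfield \<Rightarrow> 'a vfield" where
  "vf_scale f X = (\<lambda>p. tv_scale (f p) (X p))"

definition lie_bracket :: "'a vfield \<Rightarrow> 'a vfield \<Rightarrow> 'a vfield" where
  "lie_bracket X Y = (\<lambda>p f. X p (\<lambda>q. Y q f) - Y p (\<lambda>q. X q f))"

definition extend_vec :: "('a, 'n::finite) atlas \<Rightarrow> 'a \<Rightarrow> 'a tvec \<Rightarrow> 'a vfield" where
  "extend_vec A p u = (SOME X. X \<in> vector_fields A \<and> X p = u)"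

text \<open>The trace of a linear endomorphism \<open>L\<close> of the finite-dimensional space \<open>V\<close>; it does not depend
  on the basis that is chosen.\<close>

definition endo_trace :: "'a tvec set \<Rightarrow> ('a tvec \<Rightarrow> 'a tvec) \<Rightarrow> real" where
  "endo_trace V L =
     (let B = (SOME B. tv.independent B \<and> B \<subseteq> V \<and> tv.span B = V)
      in \<Sum>b\<in>B. tv.representation B (L b) b)"


section \<open>Semi-Riemannian metrics\<close>

definition symmetric_tensor :: "('a, 'n::finite) atlas \<Rightarrow> 'a tensor2 \<Rightarrow> bool" where
  "symmetric_tensor A T \<longleftrightarrow>
     (\<forall>p. \<forall>u\<in>tangent_space A p. \<forall>v\<in>tangent_space A p. \<forall>w\<in>tangent_space A p. \<forall>c.
        T p (u + v) w = T p u w + T p v w \<and>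
        T p (tv_scale c u) w = c * T p u w \<and>
        T p u w = T p w u) \<and>
     (\<forall>X\<in>vector_fields A. \<forall>Y\<in>vector_fields A. (\<lambda>p. T p (X p) (Y p)) \<in> smooth_funs A)"

definition nonzero_tensor :: "('a, 'n::finite) atlas \<Rightarrow> 'a tensor2 \<Rightarrow> bool" where
  "nonzero_tensor A T \<longleftrightarrow>
     (\<exists>p. \<exists>u\<in>tangent_space A p. \<exists>v\<in>tangent_space A p. T p u v \<noteq> 0)"

definition metric_index :: "('a, 'n::finite) atlas \<Rightarrow> 'a tensor2 \<Rightarrow> 'a \<Rightarrow> nat" where
  "metric_index A g p =
     Max {tv.dim W |W. tv.subspace W \<and> W \<subseteq> tangent_space A p \<and> (\<forall>w\<in>W. w \<noteq> 0 \<longrightarrow> g p w w < 0)}"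

definition semi_riemannian ::
    "('a::{t2_space,second_countable_topology}, 'n::finite) atlas \<Rightarrow> 'a tensor2 \<Rightarrow> bool" where
  "semi_riemannian A g \<longleftrightarrow>
     smooth_atlas A \<and> symmetric_tensor A g \<and>
     (\<forall>p. \<forall>u\<in>tangent_space A p. (\<forall>v\<in>tangent_space A p. g p u v = 0) \<longrightarrow> u = 0) \<and>
     (\<exists>\<nu>. \<forall>p. metric_index A g p = \<nu>)"


section \<open>Levi-Civita connection and curvature\<close>

definition connection ::
    "('a, 'n::finite) atlas \<Rightarrow> ('a vfield \<Rightarrow> 'a vfield \<Rightarrow> 'a vfield) \<Rightarrow> bool" where
  "connection A nab \<longleftrightarrow>
     (\<forall>X\<in>vector_fields A. \<forall>Y\<in>vector_fields A. \<forall>Z\<in>vector_fields A. \<forall>f\<in>smooth_funs A.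
        nab X Y \<in> vector_fields A \<and>
        nab (X + Y) Z = nab X Z + nab Y Z \<and>
        nab (vf_scale f X) Y = vf_scale f (nab X Y) \<and>
        nab X (Y + Z) = nab X Y + nab X Z \<and>
        nab X (vf_scale f Y) = vf_scale (\<lambda>p. X p f) Y + vf_scale f (nab X Y))"

definition levi_civita ::
    "('a, 'n::finite) atlas \<Rightarrow> 'a tensor2 \<Rightarrow> ('a vfield \<Rightarrow> 'a vfield \<Rightarrow> 'a vfield) \<Rightarrow> bool" where
  "levi_civita A g nab \<longleftrightarrow>
     connection A nab \<and>
     (\<forall>X\<in>vector_fields A. \<forall>Y\<in>vector_fields A. nab X Y - nab Y X = lie_bracket X Y) \<and>
     (\<forall>X\<in>vector_fields A. \<forall>Y\<in>vector_fields A. \<forall>Z\<in>vector_fields A. \<forall>p.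
        X p (\<lambda>q. g q (Y q) (Z q)) = g p (nab X Y p) (Z p) + g p (Y p) (nab X Z p))"

definition curvature ::
    "('a vfield \<Rightarrow> 'a vfield \<Rightarrow> 'a vfield) \<Rightarrow> 'a vfield \<Rightarrow> 'a vfield \<Rightarrow> 'a vfield \<Rightarrow> 'a vfield" where
  "curvature nab X Y Z = nab X (nab Y Z) - nab Y (nab X Z) - nab (lie_bracket X Y) Z"

definition riemann ::
    "'a tensor2 \<Rightarrow> ('a vfield \<Rightarrow> 'a vfield \<Rightarrow> 'a vfield)
      \<Rightarrow> 'a vfield \<Rightarrow> 'a vfield \<Rightarrow> 'a vfield \<Rightarrow> 'a vfield \<Rightarrow> 'a \<Rightarrow> real" where
  "riemann g nab X Y Z W p = g p (curvature nab X Y Z p) (W p)"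

definition non_flat ::
    "('a, 'n::finite) atlas \<Rightarrow> ('a vfield \<Rightarrow> 'a vfield \<Rightarrow> 'a vfield) \<Rightarrow> bool" where
  "non_flat A nab \<longleftrightarrow>
     (\<exists>X\<in>vector_fields A. \<exists>Y\<in>vector_fields A. \<exists>Z\<in>vector_fields A. curvature nab X Y Z \<noteq> 0)"

text \<open>\<open>S(v,w) = trace (u \<mapsto> R(u,v)w)\<close> on the tangent space at \<open>p\<close>. Curvature is tensorial, so its value
  at \<open>p\<close> does not depend on how the tangent vectors are extended to vector fields.\<close>

definition ricci ::
    "('a, 'n::finite) atlas \<Rightarrow> ('a vfield \<Rightarrow> 'a vfield \<Rightarrow> 'a vfield) \<Rightarrow> 'a tensor2" where
  "ricci A nab p v w = endo_trace (tangent_space A p)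
     (\<lambda>u. curvature nab (extend_vec A p u) (extend_vec A p v) (extend_vec A p w) p)"

text \<open>The Ricci operator \<open>Q\<close> is given by \<open>g(Qu,v) = S(u,v)\<close>, and \<open>r = trace Q\<close>.\<close>

definition ricci_operator ::
    "('a, 'n::finite) atlas \<Rightarrow> 'a tensor2 \<Rightarrow> ('a vfield \<Rightarrow> 'a vfield \<Rightarrow> 'a vfield)
      \<Rightarrow> 'a \<Rightarrow> 'a tvec \<Rightarrow> 'a tvec" where
  "ricci_operator A g nab p u =
     (THE w. w \<in> tangent_space A p \<and> (\<forall>v\<in>tangent_space A p. g p w v = ricci A nab p u v))"

definition scalar_curvature ::
    "('a, 'n::finite) atlas \<Rightarrow> 'a tensor2 \<Rightarrow> ('a vfield \<Rightarrow> 'a vfield \<Rightarrow> 'a vfield)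
      \<Rightarrow> 'a \<Rightarrow> real" where
  "scalar_curvature A g nab p = endo_trace (tangent_space A p) (ricci_operator A g nab p)"

definition conformal_tensor ::
    "('a, 'n::finite) atlas \<Rightarrow> 'a tensor2 \<Rightarrow> ('a vfield \<Rightarrow> 'a vfield \<Rightarrow> 'a vfield)
      \<Rightarrow> 'a vfield \<Rightarrow> 'a vfield \<Rightarrow> 'a vfield \<Rightarrow> 'a vfield \<Rightarrow> 'a \<Rightarrow> real" where
  "conformal_tensor A g nab X Y Z W p =
    (let n = real CARD('n); S = ricci A nab p; r = scalar_curvature A g nab p in
      riemann g nab X Y Z W p
      - 1 / (n - 2) *
        (S (Y p) (Z p) * g p (X p) (W p) - S (X p) (Z p) * g p (Y p) (W p)
         + g p (Y p) (Z p) * S (X p) (W p) - g p (X p) (Z p) * S (Y p) (W p))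
      + r / ((n - 1) * (n - 2)) *
        (g p (Y p) (Z p) * g p (X p) (W p) - g p (X p) (Z p) * g p (Y p) (W p)))"

definition conharmonic_tensor ::
    "('a, 'n::finite) atlas \<Rightarrow> 'a tensor2 \<Rightarrow> ('a vfield \<Rightarrow> 'a vfield \<Rightarrow> 'a vfield)
      \<Rightarrow> 'a vfield \<Rightarrow> 'a vfield \<Rightarrow> 'a vfield \<Rightarrow> 'a vfield \<Rightarrow> 'a \<Rightarrow> real" where
  "conharmonic_tensor A g nab X Y Z W p =
    (let n = real CARD('n); S = ricci A nab p in
      riemann g nab X Y Z W p
      - 1 / (n - 2) *
        (g p (X p) (W p) * S (Y p) (Z p) - g p (X p) (Z p) * S (Y p) (W p)
         + g p (Y p) (Z p) * S (X p) (W p) - g p (Y p) (W p) * S (X p) (Z p)))"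

definition semiconformal_tensor ::
    "('a, 'n::finite) atlas \<Rightarrow> 'a tensor2 \<Rightarrow> ('a vfield \<Rightarrow> 'a vfield \<Rightarrow> 'a vfield)
      \<Rightarrow> ('a \<Rightarrow> real) \<Rightarrow> ('a \<Rightarrow> real)
      \<Rightarrow> 'a vfield \<Rightarrow> 'a vfield \<Rightarrow> 'a vfield \<Rightarrow> 'a vfield \<Rightarrow> 'a \<Rightarrow> real" where
  "semiconformal_tensor A g nab l m X Y Z W p =
    (let n = real CARD('n) in
      - (n - 2) * m p * conformal_tensor A g nab X Y Z W p
      + (l p + (n - 2) * m p) * conharmonic_tensor A g nab X Y Z W p)"

definition semiconformally_flat ::
    "('a, 'n::finite) atlas \<Rightarrow> 'a tensor2 \<Rightarrow> ('a vfield \<Rightarrow> 'a vfield \<Rightarrow> 'a vfield)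
      \<Rightarrow> ('a \<Rightarrow> real) \<Rightarrow> ('a \<Rightarrow> real) \<Rightarrow> bool" where
  "semiconformally_flat A g nab l m \<longleftrightarrow>
     (\<forall>X\<in>vector_fields A. \<forall>Y\<in>vector_fields A. \<forall>Z\<in>vector_fields A. \<forall>W\<in>vector_fields A. \<forall>p.
        semiconformal_tensor A g nab l m X Y Z W p = 0)"


section \<open>Nearly quasi-Einstein and nearly quasi-constant curvature\<close>

text \<open>The parameter \<open>nab\<close> is meant to be the Levi-Civita connection of \<open>g\<close>. As for \<open>D\<close> and \<open>E\<close>,
  the condition \<open>\<beta> \<noteq> 0\<close> says that \<open>\<beta>\<close> does not vanish identically.\<close>

definition nearly_quasi_Einstein ::
    "('a::{t2_space,second_countable_topology}, 'n::finite) atlas \<Rightarrow> 'a tensor2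
      \<Rightarrow> ('a vfield \<Rightarrow> 'a vfield \<Rightarrow> 'a vfield) \<Rightarrow> bool" where
  "nearly_quasi_Einstein A g nab \<longleftrightarrow>
     semi_riemannian A g \<and> CARD('n) \<ge> 3 \<and> non_flat A nab \<and>
     (\<exists>\<alpha>\<in>smooth_funs A. \<exists>\<beta>\<in>smooth_funs A. \<exists>D.
        (\<exists>p. \<beta> p \<noteq> 0) \<and> symmetric_tensor A D \<and> nonzero_tensor A D \<and>
        (\<forall>X\<in>vector_fields A. \<forall>Y\<in>vector_fields A. \<forall>p.
           ricci A nab p (X p) (Y p) = \<alpha> p * g p (X p) (Y p) + \<beta> p * D p (X p) (Y p)))"

definition nearly_quasi_constant_curvature ::
    "('a::{t2_space,second_countable_topology}, 'n::finite) atlas \<Rightarrow> 'a tensor2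
      \<Rightarrow> ('a vfield \<Rightarrow> 'a vfield \<Rightarrow> 'a vfield) \<Rightarrow> bool" where
  "nearly_quasi_constant_curvature A g nab \<longleftrightarrow>
     semi_riemannian A g \<and>
     (\<exists>a\<in>smooth_funs A. \<exists>b\<in>smooth_funs A. \<exists>E.
        symmetric_tensor A E \<and> nonzero_tensor A E \<and>
        (\<forall>X\<in>vector_fields A. \<forall>Y\<in>vector_fields A. \<forall>Z\<in>vector_fields A. \<forall>W\<in>vector_fields A. \<forall>p.
           riemann g nab X Y Z W p =
             a p * (g p (Y p) (Z p) * g p (X p) (W p) - g p (X p) (Z p) * g p (Y p) (W p))
             + b p * (g p (X p) (W p) * E p (Y p) (Z p) - g p (X p) (Z p) * E p (Y p) (W p)
                      + g p (Y p) (Z p) * E p (X p) (W p) - g p (Y p) (W p) * E p (X p) (Z p))))"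

end

theory Submission
  imports Defs
begin

text \<open>
  Write \<open>G\<close> and \<open>g \<and> T\<close> for the curvature-like tensors built from \<open>g\<close>, respectively from \<open>g\<close> and a
  symmetric tensor \<open>T\<close>. Semiconformal flatness says
  \<open>R = 1/(n-2) g \<and> S + \<kappa> G\<close> with \<open>\<kappa> = m r / (l (n-1))\<close>, and inserting \<open>S = \<alpha> g + \<beta> D\<close> gives
  \<open>R = (2 \<alpha>/(n-2) + \<kappa>) G + \<beta>/(n-2) g \<and> D\<close>, so that \<open>E = D\<close> works.
  What is not algebra is that \<open>\<kappa>\<close> is a smooth function. No trace has to be differentiated for this:
  on vector fields, \<open>\<kappa> G(X,Y,Z,W)\<close> is a combination of smooth functions, and around each point
  one can divide by \<open>G(X,Y,Z,W)\<close>, because \<open>g\<close> is nondegenerate, the tangent space has dimension at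
  least two, and every tangent vector (a derivation) extends to a global vector field. The extension
  uses bump functions and Hadamard's lemma.
\<close>

section \<open>Calculus of \<open>C\<^sup>k\<close> and smooth functions\<close>

lemma partial_eq:
  assumes "(f has_derivative f') (at x)"
  shows "partial i f x = f' (axis i 1)"
  using frechet_derivative_at[OF assms] by (simp add: partial_def)

lemma has_derivative_partials:
  fixes f :: "real^'n::finite \<Rightarrow> real"
  assumes "f differentiable (at x)"
  shows "(f has_derivative (\<lambda>v. \<Sum>i\<in>UNIV. v $ i * partial i f x)) (at x)"
proof -
  have d: "(f has_derivative frechet_derivative f (at x)) (at x)"
    using assms frechet_derivative_works by blast
  have lin: "linear (frechet_derivative f (at x))"
    using assms by (rule linear_frechet_derivative)
  have "frechet_derivative f (at x) v = (\<Sum>i\<in>UNIV. v $ i * partial i f x)" for v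
  proof -
    have "v = (\<Sum>i\<in>UNIV. (v $ i) *\<^sub>R axis i 1)"
      using basis_expansion[of v] by (simp add: scalar_mult_eq_scaleR)
    then have "frechet_derivative f (at x) v
        = (\<Sum>i\<in>UNIV. frechet_derivative f (at x) ((v $ i) *\<^sub>R axis i 1))"
      by (metis (no_types, lifting) lin linear_sum sum.cong)
    then show ?thesis
      by (simp add: linear_cmul[OF lin] partial_def)
  qed
  then show ?thesis
    by (intro has_derivative_eq_rhs[OF d] ext)
qed

text \<open>Since \<open>U\<close> is open, agreement on \<open>U\<close> carries the full
  derivative over at each of its points, so the partial derivatives agree on \<open>U\<close> too
  and the induction continues with them.\<close>

lemma Ck_on_cong:
  assumes "open U" "\<And>x. x \<in> U \<Longrightarrow> f x = h x" "Ck_on k U f"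
  shows "Ck_on k U h"
  using assms(2,3)
proof (induction k arbitrary: f h)
  case 0
  then show ?case by (auto cong: continuous_on_cong)
next
  case (Suc k)
  have h: "(h has_derivative frechet_derivative f (at x)) (at x)" if "x \<in> U" for x
    using Suc.prems that assms(1)
    by (metis Ck_on.simps(2) frechet_derivative_works has_derivative_transform_within_open)
  have "partial i f x = partial i h x" if "x \<in> U" for i x
    using partial_eq[OF h[OF that]] by (simp add: partial_def)
  moreover have "h differentiable (at x)" if "x \<in> U" for x
    using h[OF that] differentiable_def by blast
  ultimately show ?case
    using Suc.prems(2) Suc.IH[of "partial i f" "partial i h" for i] by auto
qed

lemma Ck_on_subset: "Ck_on k U f \<Longrightarrow> V \<subseteq> U \<Longrightarrow> Ck_on k V f"
  by (induction k arbitrary: f) (auto intro: continuous_on_subset)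

lemma Ck_on_Suc_imp: "Ck_on (Suc k) U f \<Longrightarrow> Ck_on k U f"
proof (induction k arbitrary: f)
  case 0
  then show ?case
    by (auto intro!: continuous_at_imp_continuous_on differentiable_imp_continuous_within)
next
  case (Suc k)
  then show ?case using Suc.IH[of "partial i f" for i] by simp
qed

text \<open>The step of most inductions below: any formula for the derivative on \<open>U\<close>
  will do, whatever \<open>partial i f\<close> is outside \<open>U\<close>.\<close>

lemma Ck_on_SucI:
  assumes "open U" "\<And>x. x \<in> U \<Longrightarrow> (f has_derivative f' x) (at x)"
    and "\<And>i. Ck_on k U (\<lambda>x. f' x (axis i 1))"
  shows "Ck_on (Suc k) U f"
proof -
  have "Ck_on k U (partial i f)" for i
    by (rule Ck_on_cong[OF assms(1) _ assms(3)[of i]]) (simp add: partial_eq[OF assms(2)])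
  then show ?thesis using assms(2) by (auto simp: differentiable_def)
qed

lemma Ck_on_local:
  assumes "\<And>x. x \<in> U \<Longrightarrow> \<exists>W. open W \<and> x \<in> W \<and> Ck_on k W f"
  shows "Ck_on k U f"
  using assms
proof (induction k arbitrary: f)
  case 0
  have "isCont f x" if "x \<in> U" for x
    using 0[OF that] by (auto simp: continuous_on_eq_continuous_at)
  then show ?case
    by (simp add: continuous_at_imp_continuous_on)
next
  case (Suc k)
  have "f differentiable (at x)" if "x \<in> U" for x
    using Suc.prems[OF that] by auto
  moreover have "Ck_on k U (partial i f)" for i
    using Suc.prems by (intro Suc.IH) fastforce
  ultimately show ?case by simp
qed

section \<open>Closure of the classes under sums, products, composition and inversion\<close>

lemma Ck_on_const: "Ck_on k U (\<lambda>x. c)"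
  by (induction k arbitrary: c) (auto simp: partial_def[abs_def])

lemma Ck_on_nth:
  assumes "open U"
  shows "Ck_on k U (\<lambda>x. x $ i)"
proof (cases k)
  case (Suc k)
  have d: "((\<lambda>x. x $ i) has_derivative (\<lambda>v. v $ i)) (at x)" for x
    by (rule bounded_linear_imp_has_derivative[OF bounded_linear_vec_nth])
  show ?thesis unfolding Suc
    by (rule Ck_on_SucI[OF assms d Ck_on_const])
qed (auto intro!: continuous_intros)

lemma Ck_on_add:
  assumes "open U" "Ck_on k U f" "Ck_on k U h"
  shows "Ck_on k U (\<lambda>x. f x + h x)"
  using assms(2,3)
proof (induction k arbitrary: f h)
  case (Suc k)
  show ?case
    by (rule Ck_on_SucI[OF assms(1), where f' = "\<lambda>x v. frechet_derivative f (at x) v + frechet_derivative h (at x) v"])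
      (use Suc in \<open>auto simp: frechet_derivative_works partial_def[abs_def] intro!: derivative_intros\<close>)
qed (auto intro: continuous_intros)

lemma Ck_on_mult:
  assumes "open U" "Ck_on k U f" "Ck_on k U h"
  shows "Ck_on k U (\<lambda>x. f x * h x)"
  using assms(2,3)
proof (induction k arbitrary: f h)
  case (Suc k)
  have fh: "Ck_on k U f" "Ck_on k U h" using Suc.prems Ck_on_Suc_imp by blast+
  show ?case
  proof (rule Ck_on_SucI[OF assms(1)])
    show "((\<lambda>x. f x * h x) has_derivative
        (\<lambda>v. f x * frechet_derivative h (at x) v + frechet_derivative f (at x) v * h x)) (at x)"
      if "x \<in> U" for x
      using Suc.prems that by (auto simp: frechet_derivative_works intro!: has_derivative_mult)
    show "Ck_on k U (\<lambda>x. f x * frechet_derivative h (at x) (axis i 1)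
        + frechet_derivative f (at x) (axis i 1) * h x)" for i
      using Suc.prems Suc.IH fh Ck_on_add[OF assms(1)] by (auto simp: partial_def[abs_def])
  qed
qed (auto intro: continuous_intros)

lemma Ck_on_sum:
  assumes "open U" "\<And>j. j \<in> J \<Longrightarrow> Ck_on k U (f j)"
  shows "Ck_on k U (\<lambda>x. \<Sum>j\<in>J. f j x)"
  using assms(2)
  by (induction J rule: infinite_finite_induct) (simp_all add: Ck_on_const Ck_on_add[OF assms(1)])

text \<open>By the chain rule the partial derivatives of \<open>f (G x)\<close> are sums of products
  of \<open>partial j f (G x)\<close> with partial derivatives of the components of
  \<open>G\<close>. The induction varies \<open>f\<close>, so it applies to each
  \<open>partial j f\<close> once the components of \<open>G\<close> are lowered from class
  \<open>Suc k\<close> to class \<open>k\<close>.\<close>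

lemma Ck_on_compose:
  fixes f :: "real^'n::finite \<Rightarrow> real" and G :: "real^'m::finite \<Rightarrow> real^'n"
  assumes "open U" "open V" "G ` U \<subseteq> V"
    and "Ck_on k V f" "\<And>j. Ck_on k U (\<lambda>x. G x $ j)"
  shows "Ck_on k U (\<lambda>x. f (G x))"
  using assms(4,5)
proof (induction k arbitrary: f)
  case 0
  then have "continuous_on U G"
    by (simp add: continuous_on_componentwise[of U G] Basis_vec_def inner_axis)
  then show ?case using 0 assms(3) by (auto intro: continuous_on_compose2)
next
  case (Suc k)
  show ?case
  proof (rule Ck_on_SucI[OF assms(1)])
    fix x assume x: "x \<in> U"
    have "(G has_derivative (\<lambda>v. \<chi> j. frechet_derivative (\<lambda>x. G x $ j) (at x) v)) (at x)"
      unfolding has_derivative_componentwise_within[of G]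
      using Suc.prems x
      by (auto simp: Basis_vec_def inner_axis frechet_derivative_works)
    moreover have "f differentiable (at (G x))"
      using Suc.prems(1) x assms(3) by auto
    ultimately show "((\<lambda>x. f (G x)) has_derivative
        (\<lambda>v. \<Sum>j\<in>UNIV. frechet_derivative (\<lambda>x. G x $ j) (at x) v * partial j f (G x))) (at x)"
      using has_derivative_compose has_derivative_partials by fastforce
  next
    fix i
    have "Ck_on k U (\<lambda>x. partial j f (G x))" for j
      using Suc Ck_on_Suc_imp by (metis Ck_on.simps(2))
    then show "Ck_on k U (\<lambda>x. \<Sum>j\<in>UNIV. frechet_derivative (\<lambda>x. G x $ j) (at x) (axis i 1) * partial j f (G x))"
      using Suc.prems(2) by (intro Ck_on_sum Ck_on_mult assms(1)) (auto simp: partial_def[abs_def])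
  qed
qed

text \<open>The outer function comes with the sequence \<open>d\<close> of all its derivatives;
  generalising over \<open>j\<close> lets the chain rule step from \<open>d j\<close> to
  \<open>d (Suc j)\<close>.\<close>

lemma Ck_on_compose_real:
  fixes f :: "real^'n::finite \<Rightarrow> real" and d :: "nat \<Rightarrow> real \<Rightarrow> real"
  assumes "open U" "\<And>j y. (d j has_real_derivative d (Suc j) y) (at y)" "Ck_on k U f"
  shows "Ck_on k U (\<lambda>x. d j (f x))"
  using assms(3)
proof (induction k arbitrary: j)
  case 0
  have "continuous_on UNIV (d j)"
    using assms(2)[THEN DERIV_isCont] by (simp add: continuous_at_imp_continuous_on)
  then show ?case using 0 by (auto intro: continuous_on_compose2)
next
  case (Suc k)
  show ?case
  proof (rule Ck_on_SucI[OF assms(1)])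
    fix x assume "x \<in> U"
    then show "((\<lambda>x. d j (f x)) has_derivative
        (\<lambda>v. d (Suc j) (f x) * frechet_derivative f (at x) v)) (at x)"
      using has_derivative_compose[OF _ assms(2)[unfolded has_field_derivative_def],
          of f "frechet_derivative f (at x)" x UNIV j] Suc.prems
      by (simp add: frechet_derivative_works)
  next
    show "Ck_on k U (\<lambda>x. d (Suc j) (f x) * frechet_derivative f (at x) (axis i 1))" for i
      using Suc Ck_on_Suc_imp[OF Suc.prems] Ck_on_mult[OF assms(1)]
      by (auto simp: partial_def[abs_def])
  qed
qed

text \<open>The derivative of 1/f involves only 1/f itself and the derivative of \<open>f\<close>,
  so the induction bootstraps the regularity of 1/f.\<close>

lemma Ck_on_inverse:
  assumes "open U" "\<And>x. x \<in> U \<Longrightarrow> f x \<noteq> 0" "Ck_on k U f"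
  shows "Ck_on k U (\<lambda>x. inverse (f x))"
  using assms(3)
proof (induction k)
  case (Suc k)
  have i: "Ck_on k U (\<lambda>x. inverse (f x))" using Suc Ck_on_Suc_imp by blast
  show ?case
  proof (rule Ck_on_SucI[OF assms(1)])
    show "((\<lambda>x. inverse (f x)) has_derivative
        (\<lambda>v. - (inverse (f x) * frechet_derivative f (at x) v * inverse (f x)))) (at x)" if "x \<in> U" for x
      using Suc.prems that assms(2) by (auto simp: frechet_derivative_works intro!: has_derivative_inverse)
    have "Ck_on k U (\<lambda>x. (-1) * (inverse (f x) * frechet_derivative f (at x) (axis j 1) * inverse (f x)))" for j
      using i Suc.prems by (intro Ck_on_mult assms(1) Ck_on_const) (auto simp: partial_def[abs_def])
    then show "Ck_on k U (\<lambda>x. - (inverse (f x) * frechet_derivative f (at x) (axis j 1) * inverse (f x)))" for j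
      by simp
  qed
qed (use assms(2) in \<open>auto intro: continuous_intros\<close>)

section \<open>The same rules for smooth functions\<close>

lemma smooth_on_ring_operations:
  assumes "open U"
  shows smooth_on_const: "smooth_on U (\<lambda>x. c)"
    and smooth_on_nth: "smooth_on U (\<lambda>x. x $ i)"
    and smooth_on_add: "smooth_on U f \<Longrightarrow> smooth_on U h \<Longrightarrow> smooth_on U (\<lambda>x. f x + h x)"
    and smooth_on_mult: "smooth_on U f \<Longrightarrow> smooth_on U h \<Longrightarrow> smooth_on U (\<lambda>x. f x * h x)"
    and smooth_on_sum: "(\<And>j. j \<in> J \<Longrightarrow> smooth_on U (F j)) \<Longrightarrow> smooth_on U (\<lambda>x. \<Sum>j\<in>J. F j x)"
    and smooth_on_inverse:
      "(\<And>x. x \<in> U \<Longrightarrow> f x \<noteq> 0) \<Longrightarrow> smooth_on U f \<Longrightarrow> smooth_on U (\<lambda>x. inverse (f x))"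
  using Ck_on_const[of _ U c] Ck_on_nth[OF assms, of _ i] Ck_on_add[OF assms, of _ f h] Ck_on_mult[OF assms, of _ f h]
    Ck_on_sum[OF assms, of J _ F] Ck_on_inverse[OF assms, of f]
  unfolding smooth_on_def by auto

lemma smooth_on_partial: "smooth_on U f \<Longrightarrow> smooth_on U (partial i f)"
  unfolding smooth_on_def by (metis Ck_on.simps(2))

lemma smooth_on_differentiable: "smooth_on U f \<Longrightarrow> x \<in> U \<Longrightarrow> f differentiable (at x)"
  unfolding smooth_on_def by (metis Ck_on.simps(2))

lemma smooth_on_continuous: "smooth_on U f \<Longrightarrow> continuous_on U f"
  unfolding smooth_on_def by (metis Ck_on.simps(1))

lemma smooth_on_cong: "open U \<Longrightarrow> (\<And>x. x \<in> U \<Longrightarrow> f x = h x) \<Longrightarrow> smooth_on U f \<Longrightarrow> smooth_on U h"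
  unfolding smooth_on_def using Ck_on_cong[of U f h] by simp

lemma smooth_on_subset: "smooth_on U f \<Longrightarrow> V \<subseteq> U \<Longrightarrow> smooth_on V f"
  unfolding smooth_on_def using Ck_on_subset[of _ U f V] by simp

lemma smooth_on_local:
  "(\<And>x. x \<in> U \<Longrightarrow> \<exists>W. open W \<and> x \<in> W \<and> smooth_on W f) \<Longrightarrow> smooth_on U f"
  unfolding smooth_on_def by (metis Ck_on_local)

lemma smooth_on_compose:
  fixes f :: "real^'n::finite \<Rightarrow> real" and G :: "real^'m::finite \<Rightarrow> real^'n"
  assumes "open U" "open V" "G ` U \<subseteq> V"
    and "smooth_on V f" "\<And>j. smooth_on U (\<lambda>x. G x $ j)"
  shows "smooth_on U (\<lambda>x. f (G x))"
  using Ck_on_compose[OF assms(1-3), of _ f] assms(4,5) unfolding smooth_on_def by simp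

lemma partial_add:
  assumes "f differentiable (at x)" "h differentiable (at x)"
  shows "partial i (\<lambda>x. f x + h x) x = partial i f x + partial i h x"
  using partial_eq[OF has_derivative_add[OF assms[unfolded frechet_derivative_works]], of i]
  by (simp add: partial_def[of i f] partial_def[of i h])

lemma partial_mult:
  assumes "f differentiable (at x)" "h differentiable (at x)"
  shows "partial i (\<lambda>x. f x * h x) x = partial i f x * h x + f x * partial i h x"
  using partial_eq[OF has_derivative_mult[OF assms[unfolded frechet_derivative_works]], of i]
  by (simp add: partial_def[of i f] partial_def[of i h])

lemma partial_cong:
  assumes "open U" "x \<in> U" "\<And>y. y \<in> U \<Longrightarrow> f y = h y" "f differentiable (at x)"
  shows "partial i f x = partial i h x"
  unfolding partial_def
  using frechet_derivative_transform_within_open[OF assms(4,1,2,3)] by simp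

section \<open>Bump functions\<close>

text \<open>The functions P(1/x) exp(-1/x), extended by 0, form a family closed under
  differentiation; P = 1 gives the classical function that is flat at 0.\<close>

definition flat_exp :: "real poly \<Rightarrow> real \<Rightarrow> real" where
  "flat_exp P x = (if x > 0 then poly P (inverse x) * exp (- inverse x) else 0)"

lemma tendsto_poly_exp_0: "((\<lambda>y. poly P y * exp (- y)) \<longlongrightarrow> (0::real)) at_top"
proof -
  have "((\<lambda>y. \<Sum>i\<le>degree P. coeff P i * (y ^ i / exp y)) \<longlongrightarrow> (\<Sum>i\<le>degree P. coeff P i * 0)) at_top"
    by (intro tendsto_intros tendsto_power_div_exp_0)
  then show ?thesis
    by (simp add: poly_altdef exp_minus sum_distrib_right divide_inverse mult.assoc)
qed

text \<open>With y = 1/x one has dy/dx = -y^2, so the derivative of P(y) exp(-y) in x is y^2 (P -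
  P')(y) exp(-y).\<close>

lemma flat_exp_has_derivative:
  "(flat_exp P has_real_derivative flat_exp ([:0,0,1:] * (P - pderiv P)) x) (at x)"
proof -
  consider "x > 0" | "x < 0" | "x = 0" by linarith
  then show ?thesis
  proof cases
    case 1
    have "((\<lambda>x. poly P (inverse x) * exp (- inverse x)) has_real_derivative
        flat_exp ([:0,0,1:] * (P - pderiv P)) x) (at x)"
      using 1 by (auto simp: flat_exp_def field_simps power2_eq_square
          intro!: derivative_eq_intros DERIV_chain2[OF poly_DERIV])
    then show ?thesis
      by (rule has_field_derivative_transform_within_open[where S = "{0<..}"])
        (use 1 in \<open>auto simp: flat_exp_def\<close>)
  next
    case 2
    have "((\<lambda>x. 0) has_real_derivative flat_exp ([:0,0,1:] * (P - pderiv P)) x) (at x)"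
      using 2 by (auto simp: flat_exp_def)
    then show ?thesis
      by (rule has_field_derivative_transform_within_open[where S = "{..<0}"])
        (use 2 in \<open>auto simp: flat_exp_def\<close>)
  next
    case 3
    \<comment> \<open>Dividing by h multiplies the polynomial by its variable, so the right
      difference quotient at 0 is again polynomial times exponential in 1/h.\<close>
    have "((\<lambda>h. poly ([:0,1:] * P) (inverse h) * exp (- inverse h)) \<longlongrightarrow> 0) (at_right 0)"
      by (rule filterlim_compose[OF tendsto_poly_exp_0 filterlim_inverse_at_top_right])
    then have "((\<lambda>h. flat_exp P h / h) \<longlongrightarrow> 0) (at_right 0)"
      by (rule tendsto_cong[THEN iffD1, rotated])
        (auto simp: eventually_at_filter flat_exp_def field_simps)
    moreover have "((\<lambda>h. flat_exp P h / h) \<longlongrightarrow> 0) (at_left 0)"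
      by (rule tendsto_eventually) (auto simp: eventually_at_filter flat_exp_def)
    ultimately have "((\<lambda>h. flat_exp P h / h) \<longlongrightarrow> 0) (at 0)"
      by (metis filterlim_split_at)
    then show ?thesis using 3 by (auto simp: DERIV_def flat_exp_def)
  qed
qed

text \<open>Division by the value at the centre normalises \<open>bump c r c\<close> to 1. No
  plateau is built in: of the nonzero values, only the one at the centre is used later.\<close>

definition bump :: "real^'n::finite \<Rightarrow> real \<Rightarrow> real^'n \<Rightarrow> real" where
  "bump c r x = flat_exp 1 (r\<^sup>2 - (x - c) \<bullet> (x - c)) / flat_exp 1 (r\<^sup>2)"

lemma bump_center: "r > 0 \<Longrightarrow> bump c r c = 1"
  by (simp add: bump_def flat_exp_def)

lemma bump_outside: "r \<ge> 0 \<Longrightarrow> x \<notin> cball c r \<Longrightarrow> bump c r x = 0"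
proof -
  assume "r \<ge> 0" "x \<notin> cball c r"
  then have "r\<^sup>2 < (norm (x - c))\<^sup>2"
    by (intro power_strict_mono) (auto simp: dist_norm norm_minus_commute)
  then show ?thesis by (simp add: bump_def flat_exp_def dot_square_norm)
qed

lemma smooth_on_bump: "smooth_on UNIV (bump c r)"
  unfolding smooth_on_def
proof
  fix k
  \<comment> \<open>Iterating the map that sends P to X^2 (P - P'), from P = 1 on, lists all
    derivatives of \<open>flat_exp 1\<close>.\<close>
  let ?d = "\<lambda>j. flat_exp (((\<lambda>P. [:0,0,1:] * (P - pderiv P)) ^^ j) 1)"
  have "Ck_on k UNIV (\<lambda>x. r\<^sup>2 + (-1) * (\<Sum>i\<in>UNIV. (x $ i + - c $ i) * (x $ i + - c $ i)))"
    by (intro Ck_on_add Ck_on_mult Ck_on_sum Ck_on_const Ck_on_nth open_UNIV)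
  then have "Ck_on k UNIV (\<lambda>x. r\<^sup>2 - (x - c) \<bullet> (x - c))"
    by (simp add: inner_vec_def)
  then have "Ck_on k UNIV (\<lambda>x. ?d 0 (r\<^sup>2 - (x - c) \<bullet> (x - c)))"
    by (rule Ck_on_compose_real[OF open_UNIV, rotated]) (simp add: flat_exp_has_derivative del: mult_pCons_left)
  then have "Ck_on k UNIV (\<lambda>x. ?d 0 (r\<^sup>2 - (x - c) \<bullet> (x - c)) * inverse (flat_exp 1 (r\<^sup>2)))"
    by (intro Ck_on_mult Ck_on_const open_UNIV)
  then show "Ck_on k UNIV (bump c r)"
    by (simp add: bump_def[abs_def] divide_inverse)
qed

section \<open>Hadamard's lemma\<close>

text \<open>The integral of \<open>u\<close> over the segment from \<open>c\<close> to
  \<open>x\<close> with weight t^k. For k = 0 and \<open>u = partial i f\<close> these are the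
  coefficients in Hadamard's lemma; higher weights arise when they are differentiated.\<close>

definition ray_mean :: "real^'n::finite \<Rightarrow> nat \<Rightarrow> (real^'n \<Rightarrow> real) \<Rightarrow> real^'n \<Rightarrow> real" where
  "ray_mean c k u x = integral (cbox 0 1) (\<lambda>t. t ^ k * u (c + t *\<^sub>R (x - c)))"

lemma ray_in_ball:
  fixes c :: "'a::real_normed_vector"
  assumes "x \<in> ball c R" "t \<in> cbox 0 (1::real)"
  shows "c + t *\<^sub>R (x - c) \<in> ball c R"
proof -
  have "norm (t *\<^sub>R (x - c)) \<le> norm (x - c)"
    using assms(2) by (simp add: mult_left_le_one_le)
  then show ?thesis using assms(1) by (simp add: dist_norm norm_minus_commute)
qed

lemma continuous_on_ray:
  fixes u :: "'a::real_normed_vector \<Rightarrow> real"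
  assumes "continuous_on (ball c R) u"
  shows "continuous_on (ball c R \<times> cbox 0 1) (\<lambda>(x, t). t ^ k * u (c + t *\<^sub>R (x - c)))"
  unfolding split_beta
  by (intro continuous_intros continuous_on_compose2[OF assms])
    (auto simp del: mem_ball mem_box intro!: ray_in_ball)

lemma continuous_on_ray_fixed:
  fixes u :: "'a::real_normed_vector \<Rightarrow> real"
  assumes "continuous_on (ball c R) u" "x \<in> ball c R"
  shows "continuous_on (cbox 0 1) (\<lambda>t. t ^ k * u (c + t *\<^sub>R (x - c)))"
  by (intro continuous_intros continuous_on_compose2[OF assms(1)])
    (auto simp del: mem_ball mem_box intro!: ray_in_ball[OF assms(2)])

text \<open>Differentiation under the integral sign: a derivative of u(c + t (x - c)) in x brings
  out one factor t, which raises the weight to \<open>Suc k\<close>.\<close>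

lemma ray_mean_has_derivative:
  fixes u :: "real^'n::finite \<Rightarrow> real"
  assumes "Ck_on 1 (ball c R) u" "x \<in> ball c R"
  shows "(ray_mean c k u has_derivative (\<lambda>v. \<Sum>j\<in>UNIV. v $ j * ray_mean c (Suc k) (partial j u) x)) (at x)"
proof -
  have cp: "continuous_on (ball c R) (partial j u)" for j
    using assms(1) by simp
  have cu: "continuous_on (ball c R) u"
    using Ck_on_Suc_imp[of 0] assms(1) by simp
  \<comment> \<open>\<open>leibniz_rule\<close> wants the derivative of the integrand as a bounded
    linear map; \<open>blinfun_inner_right (axis j 1)\<close> is the j-th coordinate
    functional.\<close>
  define F where "F y t = (\<Sum>j\<in>UNIV. (t ^ Suc k * partial j u (c + t *\<^sub>R (y - c))) *\<^sub>R
      blinfun_inner_right (axis j 1 :: real^'n))" for y and t :: real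
  have "((\<lambda>x. integral (cbox 0 1) (\<lambda>t. t ^ k * u (c + t *\<^sub>R (x - c)))) has_derivative
      blinfun_apply (integral (cbox 0 1) (F x))) (at x within ball c R)"
  proof (rule leibniz_rule)
    fix y and t :: real assume yt: "y \<in> ball c R" "t \<in> cbox 0 1"
    have "u differentiable (at (c + t *\<^sub>R (y - c)))"
      using assms(1) ray_in_ball[OF yt] by simp
    note d = has_derivative_partials[OF this]
    have "((\<lambda>y. c + t *\<^sub>R (y - c)) has_derivative (\<lambda>v. t *\<^sub>R v)) (at y within ball c R)"
      by (auto intro!: derivative_eq_intros)
    from has_derivative_mult_right[OF has_derivative_compose[OF this d], of "t ^ k"]
    show "((\<lambda>y. t ^ k * u (c + t *\<^sub>R (y - c))) has_derivative blinfun_apply (F y t)) (at y within ball c R)"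
      by (rule has_derivative_eq_rhs)
        (auto simp: F_def blinfun.sum_left blinfun.scaleR_left inner_axis' sum_distrib_left
          algebra_simps intro!: ext sum.cong)
  next
    show "(\<lambda>t. t ^ k * u (c + t *\<^sub>R (y - c))) integrable_on cbox 0 1" if "y \<in> ball c R" for y
      by (rule integrable_continuous[OF continuous_on_ray_fixed[OF cu that]])
  next
    show "continuous_on (ball c R \<times> cbox 0 1) (\<lambda>(y, t). F y t)"
      unfolding F_def split_beta
      by (intro continuous_on_sum continuous_on_scaleR continuous_on_const
          continuous_on_ray[OF cp, of "Suc k", unfolded split_beta])
  qed (use assms(2) in auto)
  moreover have "blinfun_apply (integral (cbox 0 1) (F x)) v
      = (\<Sum>j\<in>UNIV. v $ j * ray_mean c (Suc k) (partial j u) x)" for v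
  proof -
    have cF: "continuous_on (cbox 0 1) (F x)"
      unfolding F_def
      by (intro continuous_on_sum continuous_on_scaleR continuous_on_const
          continuous_on_ray_fixed[where R = R] cp assms(2))
    have i: "(\<lambda>t. t ^ Suc k * partial j u (c + t *\<^sub>R (x - c))) integrable_on cbox 0 1" for j
      by (rule integrable_continuous[OF continuous_on_ray_fixed[OF cp assms(2)]])
    have "blinfun_apply (integral (cbox 0 1) (F x)) v
        = integral (cbox 0 1) (\<lambda>t. \<Sum>j\<in>UNIV. v $ j * (t ^ Suc k * partial j u (c + t *\<^sub>R (x - c))))"
      by (subst blinfun_apply_integral[OF integrable_continuous[OF cF]])
        (simp add: F_def blinfun.sum_left blinfun.scaleR_left inner_axis' mult.commute)
    also have "\<dots> = (\<Sum>j\<in>UNIV. integral (cbox 0 1) (\<lambda>t. v $ j * (t ^ Suc k * partial j u (c + t *\<^sub>R (x - c)))))"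
      by (rule integral_sum) (simp, rule integrable_on_mult_right[OF i])
    finally show ?thesis by (simp only: ray_mean_def integral_mult_right)
  qed
  ultimately show ?thesis
    unfolding ray_mean_def[of c k u, abs_def] at_within_open[OF assms(2) open_ball]
    by (rule has_derivative_eq_rhs[OF _ ext])
qed

text \<open>The weight \<open>k\<close> has to vary in the induction since differentiation raises
  it. This gives the smoothness of the coefficients in Hadamard's expansion.\<close>

lemma Ck_on_ray_mean:
  assumes "Ck_on n (ball c R) u"
  shows "Ck_on n (ball c R) (ray_mean c k u)"
  using assms
proof (induction n arbitrary: u k)
  case 0
  then show ?case
    using integral_continuous_on_param[OF continuous_on_ray[of c R u k]]
    by (simp add: ray_mean_def[abs_def])
next
  case (Suc n)
  have u: "Ck_on 1 (ball c R) u"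
    using Suc.prems by (induction n) (blast intro: Ck_on_Suc_imp | simp)+
  show ?case
  proof (rule Ck_on_SucI[OF open_ball ray_mean_has_derivative[OF u]])
    show "Ck_on n (ball c R) (\<lambda>x. \<Sum>j\<in>UNIV. axis i 1 $ j * ray_mean c (Suc k) (partial j u) x)" for i
      using Suc by (intro Ck_on_sum Ck_on_mult Ck_on_const open_ball) auto
  qed
qed

lemma ray_mean_center: "ray_mean c 0 u c = u c"
  by (simp add: ray_mean_def)

text \<open>The fundamental theorem of calculus along the ray c + t (x - c), with the factors x_i -
  c_i pulled out of the integral.\<close>

lemma hadamard_expansion:
  fixes f :: "real^'n::finite \<Rightarrow> real"
  assumes "smooth_on (ball c R) f" "x \<in> ball c R"
  shows "f x = f c + (\<Sum>i\<in>UNIV. (x $ i - c $ i) * ray_mean c 0 (partial i f) x)"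
proof -
  let ?D = "\<lambda>t. \<Sum>i\<in>UNIV. (x $ i - c $ i) * partial i f (c + t *\<^sub>R (x - c))"
  have "((\<lambda>t. f (c + t *\<^sub>R (x - c))) has_vector_derivative ?D t) (at t within {0..1})"
    if "t \<in> {0..1}" for t
  proof -
    have "f differentiable (at (c + t *\<^sub>R (x - c)))"
      using smooth_on_differentiable[OF assms(1)] ray_in_ball[OF assms(2)] that by auto
    note d = has_derivative_partials[OF this]
    have "((\<lambda>t. c + t *\<^sub>R (x - c)) has_derivative (\<lambda>s. s *\<^sub>R (x - c))) (at t within {0..1})"
      by (auto intro!: derivative_eq_intros)
    from has_derivative_compose[OF this d] show ?thesis
      unfolding has_vector_derivative_def
      by (rule has_derivative_eq_rhs) (auto simp: sum_distrib_left algebra_simps)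
  qed
  then have "(?D has_integral f x - f c) {0..1}"
    using fundamental_theorem_of_calculus[of 0 1 "\<lambda>t. f (c + t *\<^sub>R (x - c))"] by simp
  then have "f x - f c = integral (cbox 0 1) ?D"
    by (simp add: integral_unique)
  also have "\<dots> = (\<Sum>i\<in>UNIV. integral (cbox 0 1) (\<lambda>t. (x $ i - c $ i) * partial i f (c + t *\<^sub>R (x - c))))"
  proof (rule integral_sum)
    fix i
    have "continuous_on (ball c R) (partial i f)"
      by (intro smooth_on_continuous smooth_on_partial assms(1))
    from continuous_on_ray_fixed[OF this assms(2), of 0]
    show "(\<lambda>t. (x $ i - c $ i) * partial i f (c + t *\<^sub>R (x - c))) integrable_on cbox 0 1"
      by (intro integrable_continuous continuous_intros) simp
  qed simp
  finally show ?thesis by (simp add: ray_mean_def)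
qed

section \<open>Smooth functions and vector fields on a manifold\<close>

lemma smooth_atlas_chart:
  assumes "smooth_atlas A" "(U, \<phi>) \<in> A"
  shows "open U" "open (\<phi> ` U)" "homeomorphism U (\<phi> ` U) \<phi> (inv_into U \<phi>)"
    and "inj_on \<phi> U" "continuous_on U \<phi>" "continuous_on (\<phi> ` U) (inv_into U \<phi>)"
proof -
  show "open U" "open (\<phi> ` U)" and h: "homeomorphism U (\<phi> ` U) \<phi> (inv_into U \<phi>)"
    using assms unfolding smooth_atlas_def by blast+
  show "inj_on \<phi> U" "continuous_on U \<phi>" "continuous_on (\<phi> ` U) (inv_into U \<phi>)"
    using h unfolding homeomorphism_def by (metis inj_on_inverseI)+
qed

lemma smooth_atlas_cover:
  assumes "smooth_atlas A"
  obtains U \<phi> where "(U, \<phi>) \<in> A" "p \<in> U"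
  using assms unfolding smooth_atlas_def by blast

lemma smooth_atlas_transition:
  assumes "smooth_atlas A" "(U, \<phi>) \<in> A" "(V, \<psi>) \<in> A"
  shows "smooth_on (\<phi> ` (U \<inter> V)) (\<lambda>x. \<psi> (inv_into U \<phi> x) $ i)"
  using assms unfolding smooth_atlas_def by blast

lemma smooth_atlas_open_image:
  assumes "smooth_atlas A" "(U, \<phi>) \<in> A" "open W" "W \<subseteq> U"
  shows "open (\<phi> ` W)"
proof -
  note c = smooth_atlas_chart[OF assms(1,2)]
  have "openin (top_of_set U) W"
    using assms(3,4) by (simp add: open_subset)
  from homeomorphism_imp_open_map[OF c(3) this] show ?thesis
    using c(2) openin_open_trans by blast
qed

definition smooth_near :: "('a::topological_space, 'n::finite) atlas \<Rightarrow> ('a \<Rightarrow> real) \<Rightarrow> 'a \<Rightarrow> bool" where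
  "smooth_near A f p \<longleftrightarrow> (\<exists>U \<phi> W. (U, \<phi>) \<in> A \<and> open W \<and> p \<in> W \<and> W \<subseteq> U \<and>
     smooth_on (\<phi> ` W) (\<lambda>x. f (inv_into U \<phi> x)))"

text \<open>On the overlap with any other chart, the coordinate expression of \<open>f\<close> is
  the given smooth one composed with a transition map, so one chart around each point
  suffices.\<close>

lemma smooth_funsI_near:
  fixes A :: "('a::{t2_space,second_countable_topology}, 'n::finite) atlas"
  assumes A: "smooth_atlas A" and near: "\<And>p. smooth_near A f p"
  shows "f \<in> smooth_funs A"
proof -
  have "smooth_on (\<psi> ` V) (\<lambda>x. f (inv_into V \<psi> x))" if V: "(V, \<psi>) \<in> A" for V \<psi>
  proof (rule smooth_on_local)
    fix x assume "x \<in> \<psi> ` V"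
    then obtain q where q: "q \<in> V" "x = \<psi> q" by blast
    obtain U \<phi> W where U: "(U, \<phi>) \<in> A" and W: "open W" "q \<in> W" "W \<subseteq> U"
      and s: "smooth_on (\<phi> ` W) (\<lambda>x. f (inv_into U \<phi> x))"
      using near[of q] unfolding smooth_near_def by blast
    note cU = smooth_atlas_chart[OF A U] and cV = smooth_atlas_chart[OF A V]
    let ?N = "\<psi> ` (V \<inter> W)" and ?G = "\<lambda>y. \<phi> (inv_into V \<psi> y)"
    have oN: "open ?N"
      using W cV(1) by (intro smooth_atlas_open_image[OF A V]) auto
    have inv: "inv_into V \<psi> (\<psi> y) = y" if "y \<in> V" for y
      using cV(4) that by simp
    have "smooth_on ?N (\<lambda>y. f (inv_into U \<phi> (?G y)))"
    proof (rule smooth_on_compose[OF oN _ _ s])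
      show "open (\<phi> ` W)" by (rule smooth_atlas_open_image[OF A U W(1,3)])
      show "?G ` ?N \<subseteq> \<phi> ` W" using inv by auto
      show "smooth_on ?N (\<lambda>y. ?G y $ j)" for j
        using W(3) by (intro smooth_on_subset[OF smooth_atlas_transition[OF A V U]]) auto
    qed
    then have "smooth_on ?N (\<lambda>y. f (inv_into V \<psi> y))"
      by (rule smooth_on_cong[OF oN, rotated]) (use inv W(3) cU(4) in auto)
    then show "\<exists>N. open N \<and> x \<in> N \<and> smooth_on N (\<lambda>y. f (inv_into V \<psi> y))"
      using oN q W(2) by blast
  qed
  then show ?thesis unfolding smooth_funs_def by blast
qed

lemma smooth_funs_chart:
  "f \<in> smooth_funs A \<Longrightarrow> (U, \<phi>) \<in> A \<Longrightarrow> smooth_on (\<phi> ` U) (\<lambda>x. f (inv_into U \<phi> x))"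
  unfolding smooth_funs_def by blast

lemma smooth_funsI:
  "(\<And>U \<phi>. (U, \<phi>) \<in> A \<Longrightarrow> smooth_on (\<phi> ` U) (\<lambda>x. f (inv_into U \<phi> x))) \<Longrightarrow> f \<in> smooth_funs A"
  unfolding smooth_funs_def by blast

lemma tangent_spaceD:
  assumes "v \<in> tangent_space A p" "f \<in> smooth_funs A"
  shows tangent_space_add: "h \<in> smooth_funs A \<Longrightarrow> v (\<lambda>q. f q + h q) = v f + v h"
    and tangent_space_cmult: "v (\<lambda>q. s * f q) = s * v f"
    and tangent_space_mult: "h \<in> smooth_funs A \<Longrightarrow> v (\<lambda>q. f q * h q) = v f * h p + f p * v h"
  using assms by (simp_all add: tangent_space_def)

section \<open>The algebra of smooth functions on the manifold\<close>

context
  fixes A :: "('a::{t2_space,second_countable_topology}, 'n::finite) atlas"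
  assumes A: "smooth_atlas A"
begin

lemma smooth_funs_const: "(\<lambda>q. c) \<in> smooth_funs A"
  by (rule smooth_funsI) (rule smooth_on_const[OF smooth_atlas_chart(2)[OF A]])

lemma smooth_funs_add:
  "f \<in> smooth_funs A \<Longrightarrow> h \<in> smooth_funs A \<Longrightarrow> (\<lambda>q. f q + h q) \<in> smooth_funs A"
  by (rule smooth_funsI)
    (rule smooth_on_add[OF smooth_atlas_chart(2)[OF A] smooth_funs_chart smooth_funs_chart])

lemma smooth_funs_mult:
  "f \<in> smooth_funs A \<Longrightarrow> h \<in> smooth_funs A \<Longrightarrow> (\<lambda>q. f q * h q) \<in> smooth_funs A"
  by (rule smooth_funsI)
    (rule smooth_on_mult[OF smooth_atlas_chart(2)[OF A] smooth_funs_chart smooth_funs_chart])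

lemma smooth_funs_diff:
  assumes "f \<in> smooth_funs A" "h \<in> smooth_funs A"
  shows "(\<lambda>q. f q - h q) \<in> smooth_funs A"
  using smooth_funs_add[OF assms(1) smooth_funs_mult[OF smooth_funs_const[of "-1"] assms(2)]]
  by simp

lemma smooth_funs_sum:
  "(\<And>j. j \<in> J \<Longrightarrow> F j \<in> smooth_funs A) \<Longrightarrow> (\<lambda>q. \<Sum>j\<in>J. F j q) \<in> smooth_funs A"
  by (induction J rule: infinite_finite_induct) (simp_all add: smooth_funs_const smooth_funs_add)

text \<open>By continuity \<open>h\<close> is nonzero on a neighbourhood of \<open>p\<close>, where
  \<open>f\<close> is the quotient k/h. Smoothness of \<open>f\<close> is a conclusion here; only
  its product with \<open>h\<close> is known to be smooth.\<close>

lemma smooth_near_quotient: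
  assumes h: "h \<in> smooth_funs A" and k: "k \<in> smooth_funs A"
    and fh: "\<And>q. f q * h q = k q" and p: "h p \<noteq> 0"
  shows "smooth_near A f p"
proof -
  obtain U \<phi> where U: "(U, \<phi>) \<in> A" "p \<in> U" using smooth_atlas_cover[OF A] .
  note c = smooth_atlas_chart[OF A U(1)]
  have "continuous_on U (\<lambda>q. h (inv_into U \<phi> (\<phi> q)))"
    by (rule continuous_on_compose2[OF smooth_on_continuous[OF smooth_funs_chart[OF h U(1)]] c(5)]) simp
  then have "continuous_on U h"
    using c(4) by (simp cong: continuous_on_cong)
  then have oW: "open (U \<inter> h -` (- {0}))"
    using c(1) by (intro continuous_open_preimage) auto
  let ?W = "U \<inter> h -` (- {0})"
  have o: "open (\<phi> ` ?W)" by (rule smooth_atlas_open_image[OF A U(1) oW]) simp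
  have sub: "\<phi> ` ?W \<subseteq> \<phi> ` U" by blast
  have nz: "h (inv_into U \<phi> x) \<noteq> 0" if "x \<in> \<phi> ` ?W" for x
    using that c(4) by auto
  have "smooth_on (\<phi> ` ?W) (\<lambda>x. k (inv_into U \<phi> x) * inverse (h (inv_into U \<phi> x)))"
    by (intro smooth_on_mult smooth_on_inverse o nz smooth_on_subset[OF smooth_funs_chart[OF _ U(1)] sub] h k)
  then have "smooth_on (\<phi> ` ?W) (\<lambda>x. f (inv_into U \<phi> x))"
    by (rule smooth_on_cong[OF o, rotated]) (use nz fh[symmetric] in auto)
  then show ?thesis
    unfolding smooth_near_def using U oW p by blast
qed

section \<open>Cut-off extensions of functions and coordinate vector fields\<close>

definition bump_ext :: "'a set \<Rightarrow> ('a \<Rightarrow> real^'n) \<Rightarrow> real^'n \<Rightarrow> real \<Rightarrow> (real^'n \<Rightarrow> real) \<Rightarrow> 'a \<Rightarrow> real" where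
  "bump_ext U \<phi> c r G q = (if q \<in> U then bump c r (\<phi> q) * G (\<phi> q) else 0)"

text \<open>Inside the ball the chart shows smoothness. Any other point lies off the preimage of
  \<open>cball c r\<close>, which is compact, hence closed in the Hausdorff space, so the function
  vanishes near that point.\<close>

lemma smooth_funs_bump_ext:
  assumes U: "(U, \<phi>) \<in> A" and R: "ball c R \<subseteq> \<phi> ` U" "0 < r" "r < R"
    and G: "smooth_on (ball c R) G"
  shows "bump_ext U \<phi> c r G \<in> smooth_funs A"
proof (rule smooth_funsI_near[OF A])
  fix p
  note cU = smooth_atlas_chart[OF A U]
  show "smooth_near A (bump_ext U \<phi> c r G) p"
  proof (cases "p \<in> U \<and> \<phi> p \<in> ball c R")
    case True
    let ?W = "U \<inter> \<phi> -` ball c R"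
    have oW: "open ?W"
      using cU(1,5) by (intro continuous_open_preimage) auto
    have im: "\<phi> ` ?W = ball c R" using R(1) by blast
    have "smooth_on (ball c R) (\<lambda>x. bump c r x * G x)"
      by (intro smooth_on_mult open_ball G smooth_on_subset[OF smooth_on_bump]) simp
    then have "smooth_on (ball c R) (\<lambda>x. bump_ext U \<phi> c r G (inv_into U \<phi> x))"
    proof (rule smooth_on_cong[OF open_ball, rotated])
      fix x assume "x \<in> ball c R"
      then have "x \<in> \<phi> ` U" using R(1) by blast
      then show "bump c r x * G x = bump_ext U \<phi> c r G (inv_into U \<phi> x)"
        by (simp add: bump_ext_def inv_into_into f_inv_into_f)
    qed
    then show ?thesis
      unfolding smooth_near_def using U oW True im by (metis Int_iff inf_le1 vimage_eq)
  next
    case False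
    let ?K = "inv_into U \<phi> ` cball c r"
    have sub: "cball c r \<subseteq> ball c R" using R by (simp add: subset_iff)
    have "compact ?K"
      using cU(6) R(1) sub by (intro compact_continuous_image) (auto intro: continuous_on_subset)
    then have K: "closed ?K" by (rule compact_imp_closed)
    have pK: "p \<notin> ?K"
    proof
      assume "p \<in> ?K"
      then obtain x where "x \<in> cball c r" "p = inv_into U \<phi> x" by blast
      moreover then have "x \<in> ball c R" "x \<in> \<phi> ` U" using sub R(1) by blast+
      ultimately show False using False by (simp add: inv_into_into f_inv_into_f)
    qed
    obtain V \<psi> where V: "(V, \<psi>) \<in> A" "p \<in> V" using smooth_atlas_cover[OF A] .
    note cV = smooth_atlas_chart[OF A V(1)]
    have oW: "open (V - ?K)" using K cV(1) by blast
    have o: "open (\<psi> ` (V - ?K))" by (rule smooth_atlas_open_image[OF A V(1) oW]) blast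
    have z: "bump_ext U \<phi> c r G q = 0" if "q \<notin> ?K" for q
    proof (cases "q \<in> U")
      case True
      then have "inv_into U \<phi> (\<phi> q) = q" using cU(4) by simp
      then have "\<phi> q \<notin> cball c r" using that by (metis imageI)
      from bump_outside[OF less_imp_le[OF R(2)] this] show ?thesis by (simp add: bump_ext_def)
    qed (simp add: bump_ext_def)
    have "smooth_on (\<psi> ` (V - ?K)) (\<lambda>x. 0)" by (rule smooth_on_const[OF o])
    then have "smooth_on (\<psi> ` (V - ?K)) (\<lambda>x. bump_ext U \<phi> c r G (inv_into V \<psi> x))"
      by (rule smooth_on_cong[OF o, rotated]) (use cV(4) z in auto)
    then show ?thesis
      unfolding smooth_near_def using V oW pK by blast
  qed
qed

text \<open>The coordinate field with constant coefficients \<open>a\<close>, damped by the bump.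
  The value 0 on non-smooth \<open>f\<close> is what \<open>tangent_space\<close>
  prescribes.\<close>

definition bump_field :: "'a set \<Rightarrow> ('a \<Rightarrow> real^'n) \<Rightarrow> real^'n \<Rightarrow> real \<Rightarrow> real^'n \<Rightarrow> 'a vfield" where
  "bump_field U \<phi> c r a q f = (if f \<in> smooth_funs A
     then bump_ext U \<phi> c r (\<lambda>x. \<Sum>i\<in>UNIV. a $ i * partial i (\<lambda>x. f (inv_into U \<phi> x)) x) q else 0)"

lemma vector_fields_bump_field:
  assumes U: "(U, \<phi>) \<in> A" and R: "ball c R \<subseteq> \<phi> ` U" "0 < r" "r < R"
  shows "bump_field U \<phi> c r a \<in> vector_fields A"
proof -
  note cU = smooth_atlas_chart[OF A U]
  have diff: "(\<lambda>x. f (inv_into U \<phi> x)) differentiable (at (\<phi> q))" if "f \<in> smooth_funs A" "q \<in> U" for f q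
    using smooth_on_differentiable[OF smooth_funs_chart[OF that(1) U]] that(2) by blast
  have "bump_field U \<phi> c r a q \<in> tangent_space A q" for q
  proof (cases "q \<in> U")
    case True
    have "bump_field U \<phi> c r a q (\<lambda>p. f p + h p) = bump_field U \<phi> c r a q f + bump_field U \<phi> c r a q h"
      if "f \<in> smooth_funs A" "h \<in> smooth_funs A" for f h
      using that True smooth_funs_add[OF that]
      by (simp add: bump_field_def bump_ext_def partial_add[OF diff diff] algebra_simps sum.distrib)
    moreover have m: "bump_field U \<phi> c r a q (\<lambda>p. f p * h p)
        = bump_field U \<phi> c r a q f * h q + f q * bump_field U \<phi> c r a q h"
      if "f \<in> smooth_funs A" "h \<in> smooth_funs A" for f h
    proof -
      have "inv_into U \<phi> (\<phi> q) = q" using True cU(4) by simp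
      then show ?thesis
        using that True smooth_funs_mult[OF that]
        by (simp add: bump_field_def bump_ext_def partial_mult[OF diff diff] algebra_simps
            sum.distrib sum_distrib_left)
    qed
    moreover have "bump_field U \<phi> c r a q (\<lambda>p. s * f p) = s * bump_field U \<phi> c r a q f"
      if "f \<in> smooth_funs A" for f s
    proof -
      \<comment> \<open>The field kills constants, so homogeneity is the product rule with a
        constant factor.\<close>
      have "bump_field U \<phi> c r a q (\<lambda>p. s) = 0"
        by (simp add: bump_field_def bump_ext_def partial_def)
      then show ?thesis using m[OF smooth_funs_const[of s] that] by simp
    qed
    ultimately show ?thesis by (simp add: tangent_space_def bump_field_def)
  qed (simp add: tangent_space_def bump_field_def bump_ext_def)
  moreover have "(\<lambda>q. bump_field U \<phi> c r a q f) \<in> smooth_funs A" if f: "f \<in> smooth_funs A" for f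
  proof -
    have "smooth_on (ball c R) (\<lambda>x. \<Sum>i\<in>UNIV. a $ i * partial i (\<lambda>x. f (inv_into U \<phi> x)) x)"
      by (intro smooth_on_sum smooth_on_mult smooth_on_const open_ball smooth_on_partial
          smooth_on_subset[OF smooth_funs_chart[OF f U] R(1)])
    from smooth_funs_bump_ext[OF U R this] show ?thesis
      using f by (simp add: bump_field_def)
  qed
  ultimately show ?thesis by (simp add: vector_fields_def)
qed

section \<open>Tangent vectors in coordinates\<close>

lemma tangent_space_sum:
  assumes v: "v \<in> tangent_space A p" and F: "\<And>j. j \<in> J \<Longrightarrow> F j \<in> smooth_funs A"
  shows "v (\<lambda>q. \<Sum>j\<in>J. F j q) = (\<Sum>j\<in>J. v (F j))"
proof -
  have z: "v (\<lambda>q. 0) = 0"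
    using tangent_space_cmult[OF v smooth_funs_const, of 0 0] by simp
  show ?thesis using F
  proof (induction J rule: infinite_finite_induct)
    case (insert j J)
    then have "F j \<in> smooth_funs A" "(\<lambda>q. \<Sum>j\<in>J. F j q) \<in> smooth_funs A"
      by (auto intro: smooth_funs_sum)
    then show ?case using tangent_space_add[OF v] insert by simp
  qed (simp_all add: z)
qed

text \<open>Derivations act on global functions only, so the coordinates x_i - c_i and Hadamard's
  coefficients are first cut off by the bump. As x_i - c_i vanishes at \<open>p\<close>, the product
  rule leaves just the value of \<open>v\<close> on it times the i-th coefficient at
  \<open>p\<close>, which is the partial derivative.\<close>

lemma tangent_vector_coords:
  assumes U: "(U, \<phi>) \<in> A" "p \<in> U" and R: "ball (\<phi> p) R \<subseteq> \<phi> ` U" "0 < r" "r < R"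
    and v: "v \<in> tangent_space A p" and f: "f \<in> smooth_funs A"
  shows "v f = (\<Sum>i\<in>UNIV. v (bump_ext U \<phi> (\<phi> p) r (\<lambda>x. x $ i - \<phi> p $ i))
    * partial i (\<lambda>x. f (inv_into U \<phi> x)) (\<phi> p))"
proof -
  note cU = smooth_atlas_chart[OF A U(1)]
  let ?c = "\<phi> p" and ?F = "\<lambda>x. f (inv_into U \<phi> x)"
  have inv: "inv_into U \<phi> (\<phi> q) = q" if "q \<in> U" for q using that cU(4) by simp
  have F: "smooth_on (ball ?c R) ?F"
    by (rule smooth_on_subset[OF smooth_funs_chart[OF f U(1)] R(1)])
  define \<rho> where "\<rho> = bump_ext U \<phi> ?c r (\<lambda>x. 1)"
  define x where "x i = bump_ext U \<phi> ?c r (\<lambda>x. x $ i - ?c $ i)" for i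
  define k where "k i = bump_ext U \<phi> ?c r (ray_mean ?c 0 (partial i ?F))" for i
  note ext = smooth_funs_bump_ext[OF U(1) R]
  have s\<rho>: "\<rho> \<in> smooth_funs A" unfolding \<rho>_def by (rule ext[OF smooth_on_const]) simp
  have sx: "x i \<in> smooth_funs A" for i
    unfolding x_def
    using smooth_on_add[OF open_ball smooth_on_nth[OF open_ball] smooth_on_const[OF open_ball, of _ _ "- ?c $ i"]]
    by (intro ext) simp
  have sk: "k i \<in> smooth_funs A" for i
    unfolding k_def using smooth_on_partial[OF F, of i]
    by (intro ext) (simp add: smooth_on_def Ck_on_ray_mean)
  have p: "\<rho> p = 1" "x i p = 0" "k i p = partial i ?F ?c" for i
    using U(2) R(2) by (simp_all add: \<rho>_def x_def k_def bump_ext_def bump_center ray_mean_center)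
  \<comment> \<open>Multiplying Hadamard's expansion by \<open>\<rho>\<^sup>2\<close> turns it into an identity of global smooth functions.\<close>
  have expansion: "\<rho> q * \<rho> q * f q = f p * (\<rho> q * \<rho> q) + (\<Sum>i\<in>UNIV. x i q * k i q)" for q
  proof (cases "q \<in> U")
    case True
    show ?thesis
    proof (cases "\<phi> q \<in> ball ?c R")
      case True
      have "f q = f p + (\<Sum>i\<in>UNIV. (\<phi> q $ i - ?c $ i) * ray_mean ?c 0 (partial i ?F) (\<phi> q))"
        using hadamard_expansion[OF F True] inv \<open>q \<in> U\<close> U(2) by simp
      then show ?thesis using \<open>q \<in> U\<close>
        by (simp add: \<rho>_def x_def k_def bump_ext_def algebra_simps sum_distrib_left)
    next
      case False
      then have "bump ?c r (\<phi> q) = 0" using R by (intro bump_outside) auto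
      then show ?thesis by (simp add: \<rho>_def x_def k_def bump_ext_def)
    qed
  qed (simp add: \<rho>_def x_def k_def bump_ext_def)
  note mult = tangent_space_mult[OF v]
  have s\<rho>2: "(\<lambda>q. \<rho> q * \<rho> q) \<in> smooth_funs A" by (intro smooth_funs_mult s\<rho>)
  have sxk: "(\<lambda>q. x i q * k i q) \<in> smooth_funs A" for i by (intro smooth_funs_mult sx sk)
  \<comment> \<open>The product of f(p) with the value of \<open>v\<close> on \<rho>^2 appears on
    both sides and cancels in the end.\<close>
  have "v (\<lambda>q. \<rho> q * \<rho> q) * f p + v f = v (\<lambda>q. \<rho> q * \<rho> q * f q)"
    by (simp add: mult[OF s\<rho>2 f] p)
  also have "\<dots> = v (\<lambda>q. f p * (\<rho> q * \<rho> q) + (\<Sum>i\<in>UNIV. x i q * k i q))"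
    by (simp only: expansion)
  also have "\<dots> = v (\<lambda>q. f p * (\<rho> q * \<rho> q)) + v (\<lambda>q. \<Sum>i\<in>UNIV. x i q * k i q)"
    by (intro tangent_space_add[OF v] smooth_funs_mult smooth_funs_const smooth_funs_sum s\<rho> sx sk)
  also have "v (\<lambda>q. f p * (\<rho> q * \<rho> q)) = f p * v (\<lambda>q. \<rho> q * \<rho> q)"
    by (rule tangent_space_cmult[OF v s\<rho>2])
  also have "v (\<lambda>q. \<Sum>i\<in>UNIV. x i q * k i q) = (\<Sum>i\<in>UNIV. v (x i) * partial i ?F ?c)"
    by (simp add: tangent_space_sum[OF v sxk] mult[OF sx sk] p)
  finally show ?thesis by (simp add: x_def)
qed

lemma ball_in_chart:
  obtains U \<phi> r R where "(U, \<phi>) \<in> A" "p \<in> U" "ball (\<phi> p) R \<subseteq> \<phi> ` U" "0 < r" "r < R"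
proof -
  obtain U \<phi> where U: "(U, \<phi>) \<in> A" "p \<in> U" using smooth_atlas_cover[OF A] .
  then obtain R where "0 < R" "ball (\<phi> p) R \<subseteq> \<phi> ` U"
    using smooth_atlas_chart(2)[OF A U(1)] by (meson imageI openE)
  then show ?thesis using that[OF U, of R "R / 2"] by simp
qed

text \<open>The coordinates of \<open>v\<close> serve as constant coefficients of a bump field; at
  \<open>p\<close> the bump is 1, and \<open>tangent_vector_coords\<close> identifies the value with
  \<open>v\<close>.\<close>

lemma vector_field_through:
  assumes v: "v \<in> tangent_space A p"
  obtains X where "X \<in> vector_fields A" "X p = v"
proof -
  obtain U \<phi> r R where c: "(U, \<phi>) \<in> A" "p \<in> U" "ball (\<phi> p) R \<subseteq> \<phi> ` U" "0 < r" "r < R"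
    using ball_in_chart .
  let ?a = "\<chi> i. v (bump_ext U \<phi> (\<phi> p) r (\<lambda>x. x $ i - \<phi> p $ i))"
  have "bump_field U \<phi> (\<phi> p) r ?a p = v"
  proof
    fix f
    show "bump_field U \<phi> (\<phi> p) r ?a p f = v f"
    proof (cases "f \<in> smooth_funs A")
      case True
      then show ?thesis
        using tangent_vector_coords[OF c v True] c
        by (simp add: bump_field_def bump_ext_def bump_center)
    next
      case False
      then show ?thesis using v by (simp add: bump_field_def tangent_space_def)
    qed
  qed
  then show ?thesis using that vector_fields_bump_field[OF c(1,3-5)] by blast
qed

text \<open>Two coordinate fields taken at \<open>p\<close> are told apart by the cut-off coordinate
  functions \<open>x l\<close>, on which they take the values of the Kronecker delta.\<close>

lemma tangent_space_not_line:
  assumes "CARD('n) \<ge> 2"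
  obtains u v where "u \<in> tangent_space A p" "v \<in> tangent_space A p"
    "u \<noteq> 0" "\<And>s. v \<noteq> tv_scale s u"
proof -
  obtain U \<phi> r R where c: "(U, \<phi>) \<in> A" "p \<in> U" "ball (\<phi> p) R \<subseteq> \<phi> ` U" "0 < r" "r < R"
    using ball_in_chart .
  obtain i j :: 'n where ij: "i \<noteq> j"
    using assms by (metis card_le_Suc0_iff_eq finite_class.finite_UNIV UNIV_I numeral_2_eq_2 not_less_eq_eq)
  let ?w = "\<lambda>k. bump_field U \<phi> (\<phi> p) r (axis k 1) p"
  define x where "x l = bump_ext U \<phi> (\<phi> p) r (\<lambda>x. x $ l - \<phi> p $ l)" for l
  have w: "?w k (x l) = (if k = l then 1 else 0)" for k l
  proof -
    let ?G = "\<lambda>y. bump (\<phi> p) r y * (y $ l - \<phi> p $ l)"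
    have sl: "smooth_on (ball (\<phi> p) R) (\<lambda>x. x $ l - \<phi> p $ l)"
      using smooth_on_add[OF open_ball smooth_on_nth[OF open_ball] smooth_on_const[OF open_ball, of _ _ "- \<phi> p $ l"]]
      by simp
    have dl: "((\<lambda>x. x $ l - \<phi> p $ l) has_derivative (\<lambda>v. v $ l)) (at (\<phi> p))"
      using has_derivative_diff[OF bounded_linear_imp_has_derivative[OF bounded_linear_vec_nth] has_derivative_const]
      by simp
    have sx: "x l \<in> smooth_funs A"
      unfolding x_def by (rule smooth_funs_bump_ext[OF c(1,3-5) sl])
    have db: "bump (\<phi> p) r differentiable (at (\<phi> p))"
      by (rule smooth_on_differentiable[OF smooth_on_bump UNIV_I])
    have dl': "(\<lambda>x. x $ l - \<phi> p $ l) differentiable (at (\<phi> p))"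
      using dl differentiable_def by blast
    have "partial k (\<lambda>y. x l (inv_into U \<phi> y)) (\<phi> p) = partial k ?G (\<phi> p)" for k
    proof (rule partial_cong[symmetric, where U = "ball (\<phi> p) R"])
      show "?G differentiable (at (\<phi> p))" using db dl' by (rule differentiable_mult)
      fix y assume "y \<in> ball (\<phi> p) R"
      then have "y \<in> \<phi> ` U" using c(3) by blast
      then show "?G y = x l (inv_into U \<phi> y)"
        by (simp add: x_def bump_ext_def inv_into_into f_inv_into_f)
    qed (use c in auto)
    \<comment> \<open>The derivative of the bump does not contribute, because its cofactor vanishes
      at the centre.\<close>
    also have "partial k ?G (\<phi> p) = axis k 1 $ l" for k
      by (simp add: partial_mult[OF db dl'] partial_eq[OF dl] bump_center[OF c(4)])
    finally have "partial m (\<lambda>y. x l (inv_into U \<phi> y)) (\<phi> p) = axis m 1 $ l" for m .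
    then show ?thesis
      using sx c(2) by (simp add: bump_field_def bump_ext_def bump_center[OF c(4)] axis_def
          if_distrib[where f = "\<lambda>t. t * _"] cong: if_cong)
  qed
  have "?w k \<in> tangent_space A p" for k
    using vector_fields_bump_field[OF c(1,3-5)] by (simp add: vector_fields_def)
  moreover have "?w i \<noteq> 0" using w[of i i] by (metis one_neq_zero zero_fun_def)
  moreover have "?w j \<noteq> tv_scale s (?w i)" for s
    using w[of j j] w[of i j] ij by (metis mult_zero_right one_neq_zero tv_scale_def)
  ultimately show ?thesis using that by blast
qed

end

section \<open>Semiconformally flat manifolds\<close>

lemma tangent_space_add_scale:
  assumes "u \<in> tangent_space A p" "v \<in> tangent_space A p"
  shows "v + tv_scale s u \<in> tangent_space A p"
  using assms by (simp add: tangent_space_def tv_scale_def algebra_simps)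

lemma vector_fields_diff:
  fixes A :: "('a::{t2_space,second_countable_topology}, 'n::finite) atlas"
  assumes "smooth_atlas A" "X \<in> vector_fields A" "Y \<in> vector_fields A"
  shows "X - Y \<in> vector_fields A"
proof -
  have "(X - Y) p = X p + tv_scale (-1) (Y p)" for p
    by (simp add: tv_scale_def fun_eq_iff)
  then show ?thesis
    using assms tangent_space_add_scale[of "Y p" A p "X p" "-1" for p]
    by (simp add: vector_fields_def smooth_funs_diff)
qed

text \<open>Freedom from torsion writes the Lie bracket as \<open>nab X Y - nab Y X\<close>, which
  makes it a vector field without a computation in charts.\<close>

lemma vector_fields_curvature:
  fixes A :: "('a::{t2_space,second_countable_topology}, 'n::finite) atlas"
  assumes A: "smooth_atlas A" and "levi_civita A g nab"
    and X: "X \<in> vector_fields A" and Y: "Y \<in> vector_fields A" and Z: "Z \<in> vector_fields A"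
  shows "curvature nab X Y Z \<in> vector_fields A"
proof -
  have nab: "nab V W \<in> vector_fields A" if "V \<in> vector_fields A" "W \<in> vector_fields A" for V W
    using assms(2) that smooth_funs_const[OF A] unfolding levi_civita_def connection_def by blast
  have "nab X Y - nab Y X = lie_bracket X Y"
    using assms(2) X Y unfolding levi_civita_def by blast
  then have "lie_bracket X Y \<in> vector_fields A"
    using vector_fields_diff[OF A nab[OF X Y] nab[OF Y X]] by simp
  then show ?thesis
    unfolding curvature_def by (intro vector_fields_diff[OF A] nab X Y Z)
qed

text \<open>Choosing \<open>Z\<close> and \<open>W\<close> independently of \<open>X\<close> and
  \<open>Y\<close> avoids trouble with null directions: nondegeneracy gives \<open>w\<close> with
  g(u,w) nonzero, and then \<open>z\<close> not orthogonal to a suitable v - s u.\<close>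

lemma metric_square_nonzero:
  fixes A :: "('a::{t2_space,second_countable_topology}, 'n::finite) atlas"
  assumes g: "semi_riemannian A g" and n: "CARD('n) \<ge> 2"
  obtains X Y Z W where "X \<in> vector_fields A" "Y \<in> vector_fields A" "Z \<in> vector_fields A"
    "W \<in> vector_fields A"
    "g p (Y p) (Z p) * g p (X p) (W p) - g p (X p) (Z p) * g p (Y p) (W p) \<noteq> 0"
proof -
  have A: "smooth_atlas A" using g unfolding semi_riemannian_def by blast
  have nondeg: "\<exists>w\<in>tangent_space A p. g p u w \<noteq> 0" if "u \<in> tangent_space A p" "u \<noteq> 0" for u
    using g that unfolding semi_riemannian_def by blast
  obtain u v where u: "u \<in> tangent_space A p" "u \<noteq> 0"
    and v: "v \<in> tangent_space A p" "\<And>s. v \<noteq> tv_scale s u"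
    using tangent_space_not_line[OF A n] by metis
  obtain w where w: "w \<in> tangent_space A p" "g p u w \<noteq> 0" using nondeg u by blast
  \<comment> \<open>This makes v - s u orthogonal to \<open>w\<close>, and the expression factors as
    g(u,w) g(v - s u, z).\<close>
  define s where "s = g p v w / g p u w"
  have "v + tv_scale (- s) u \<noteq> 0"
    using v(2)[of s] by (auto simp: fun_eq_iff tv_scale_def)
  then obtain z where z: "z \<in> tangent_space A p" "g p (v + tv_scale (- s) u) z \<noteq> 0"
    using nondeg tangent_space_add_scale[OF u(1) v(1)] by blast
  have su: "tv_scale (- s) u \<in> tangent_space A p"
    using u(1) by (simp add: tangent_space_def tv_scale_def algebra_simps)
  have lin: "\<forall>p. \<forall>u\<in>tangent_space A p. \<forall>v\<in>tangent_space A p. \<forall>w\<in>tangent_space A p. \<forall>c.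
      g p (u + v) w = g p u w + g p v w \<and> g p (tv_scale c u) w = c * g p u w \<and> g p u w = g p w u"
    using g unfolding semi_riemannian_def symmetric_tensor_def by (elim conjE)
  have gz: "g p (v + tv_scale (- s) u) z = g p v z - s * g p u z"
    using lin[rule_format, OF v(1) su z(1), THEN conjunct1]
      lin[rule_format, OF u(1) u(1) z(1), THEN conjunct2, THEN conjunct1, of "- s"]
    by (simp only:)
  have "g p v z * g p u w - g p u z * g p v w = g p u w * (g p v z - s * g p u z)"
    using w(2) by (simp add: s_def algebra_simps)
  then have "g p v z * g p u w - g p u z * g p v w \<noteq> 0"
    using z(2) w(2) unfolding gz by simp
  moreover obtain X where "X \<in> vector_fields A" "X p = u" using vector_field_through[OF A u(1)] .
  moreover obtain Y where "Y \<in> vector_fields A" "Y p = v" using vector_field_through[OF A v(1)] .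
  moreover obtain Z where "Z \<in> vector_fields A" "Z p = z" using vector_field_through[OF A z(1)] .
  moreover obtain W where "W \<in> vector_fields A" "W p = w" using vector_field_through[OF A w(1)] .
  ultimately show ?thesis using that by blast
qed

section \<open>Curvature in terms of \<open>g\<close> and \<open>D\<close>, and smoothness of the
  coefficients\<close>

theorem theorem3p1:
  fixes A :: "('a::{t2_space,second_countable_topology}, 'n::finite) atlas"
    and g :: "'a tensor2"
    and nab :: "'a vfield \<Rightarrow> 'a vfield \<Rightarrow> 'a vfield"
    and l m :: "'a \<Rightarrow> real"
  assumes "semi_riemannian A g"
    and "levi_civita A g nab"
    and "CARD('n) > 3"
    and "nearly_quasi_Einstein A g nab"
    and "l \<in> smooth_funs A" and "\<forall>p. l p \<noteq> 0"
    and "m \<in> smooth_funs A" and "\<forall>p. m p \<noteq> 0"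
    and "semiconformally_flat A g nab l m"
  shows "nearly_quasi_constant_curvature A g nab"
proof -
  have A: "smooth_atlas A" and g: "symmetric_tensor A g"
    using assms(1) unfolding semi_riemannian_def by blast+
  obtain \<alpha> \<beta> D where \<alpha>: "\<alpha> \<in> smooth_funs A" and \<beta>: "\<beta> \<in> smooth_funs A"
    and D: "symmetric_tensor A D" "nonzero_tensor A D"
    and S: "\<And>X Y p. X \<in> vector_fields A \<Longrightarrow> Y \<in> vector_fields A \<Longrightarrow>
      ricci A nab p (X p) (Y p) = \<alpha> p * g p (X p) (Y p) + \<beta> p * D p (X p) (Y p)"
    using assms(4) unfolding nearly_quasi_Einstein_def by blast
  define k where "k = 1 / (real CARD('n) - 2)"
  \<comment> \<open>Found by solving the flatness equation for the curvature; dividing by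
    \<open>l\<close> is possible since it has no zeros.\<close>
  define \<kappa> where "\<kappa> p = m p * scalar_curvature A g nab p / (l p * (real CARD('n) - 1))" for p
  define G where "G X Y Z W p = g p (Y p) (Z p) * g p (X p) (W p) - g p (X p) (Z p) * g p (Y p) (W p)"
    for X Y Z W :: "'a vfield" and p
  define K where "K X Y Z W p = g p (X p) (W p) * D p (Y p) (Z p) - g p (X p) (Z p) * D p (Y p) (W p)
      + g p (Y p) (Z p) * D p (X p) (W p) - g p (Y p) (W p) * D p (X p) (Z p)"
    for X Y Z W :: "'a vfield" and p
  have R: "riemann g nab X Y Z W p = (2 * k * \<alpha> p + \<kappa> p) * G X Y Z W p + k * \<beta> p * K X Y Z W p"
    if f: "X \<in> vector_fields A" "Y \<in> vector_fields A" "Z \<in> vector_fields A" "W \<in> vector_fields A"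
    for X Y Z W p
  proof -
    let ?n = "real CARD('n)"
    note Sf = S[OF f(2,3)] S[OF f(1,3)] S[OF f(1,4)] S[OF f(2,4)]
    define t where "t = scalar_curvature A g nab p / ((?n - 1) * (?n - 2))"
    \<comment> \<open>The conharmonic tensor after substituting the Ricci tensor; putting
      \<open>g\<close> in place of \<open>D\<close> turns \<open>K\<close> into 2 G, hence the
      factor 2.\<close>
    define H where "H = riemann g nab X Y Z W p - k * (2 * \<alpha> p * G X Y Z W p + \<beta> p * K X Y Z W p)"
    have H: "conharmonic_tensor A g nab X Y Z W p = H"
      unfolding conharmonic_tensor_def Let_def Sf H_def G_def K_def k_def[symmetric]
      by (simp add: algebra_simps)
    have C: "conformal_tensor A g nab X Y Z W p = H + t * G X Y Z W p"
      unfolding conformal_tensor_def Let_def Sf H_def G_def K_def k_def[symmetric] t_def[symmetric]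
      by (simp add: algebra_simps)
    have "semiconformal_tensor A g nab l m X Y Z W p = 0"
      using assms(9) f unfolding semiconformally_flat_def by blast
    \<comment> \<open>The terms (n-2) m H of the two parts cancel, leaving l H and the scalar
      curvature term of the conformal tensor.\<close>
    then have "l p * H = (?n - 2) * m p * t * G X Y Z W p"
      by (simp add: semiconformal_tensor_def H C algebra_simps)
    also have "\<dots> = l p * (\<kappa> p * G X Y Z W p)"
      using assms(3,6) by (simp add: \<kappa>_def t_def)
    finally have "H = \<kappa> p * G X Y Z W p"
      using assms(6) by simp
    then show ?thesis by (simp add: H_def algebra_simps)
  qed
  have T: "(\<lambda>p. T p (X p) (Y p)) \<in> smooth_funs A"
    if "symmetric_tensor A T" "X \<in> vector_fields A" "Y \<in> vector_fields A" for T X Y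
    using that unfolding symmetric_tensor_def by blast
  note smooth = smooth_funs_add[OF A] smooth_funs_diff[OF A] smooth_funs_mult[OF A]
    smooth_funs_const[OF A]
  have \<kappa>: "\<kappa> \<in> smooth_funs A"
  proof (rule smooth_funsI_near[OF A])
    fix p
    have n: "CARD('n) \<ge> 2" using assms(3) by simp
    \<comment> \<open>The four fields depend on \<open>p\<close>, which is harmless because
      smoothness is tested near one point at a time.\<close>
    obtain X Y Z W where f: "X \<in> vector_fields A" "Y \<in> vector_fields A" "Z \<in> vector_fields A"
      "W \<in> vector_fields A" and nz: "G X Y Z W p \<noteq> 0"
      unfolding G_def using metric_square_nonzero[OF assms(1) n] .
    have sG: "(\<lambda>p. G X Y Z W p) \<in> smooth_funs A"
      unfolding G_def by (intro smooth T[OF g] f)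
    have sK: "(\<lambda>p. K X Y Z W p) \<in> smooth_funs A"
      unfolding K_def by (intro smooth T[OF g] T[OF D(1)] f)
    have sR: "(\<lambda>p. riemann g nab X Y Z W p) \<in> smooth_funs A"
      unfolding riemann_def by (intro T[OF g] f vector_fields_curvature[OF A assms(2)])
    have sQ: "(\<lambda>q. riemann g nab X Y Z W q - 2 * k * \<alpha> q * G X Y Z W q - k * \<beta> q * K X Y Z W q)
        \<in> smooth_funs A"
      by (intro smooth sR sG sK \<alpha> \<beta>)
    \<comment> \<open>Solved for \<kappa>, formula \<open>R\<close> presents it as a quotient of
      smooth functions wherever \<open>G\<close> is nonzero.\<close>
    have "\<kappa> q * G X Y Z W q
        = riemann g nab X Y Z W q - 2 * k * \<alpha> q * G X Y Z W q - k * \<beta> q * K X Y Z W q" for q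
      by (simp add: R[OF f] algebra_simps)
    from smooth_near_quotient[OF A sG sQ this nz] show "smooth_near A \<kappa> p" .
  qed
  have a: "(\<lambda>p. 2 * k * \<alpha> p + \<kappa> p) \<in> smooth_funs A" and b: "(\<lambda>p. k * \<beta> p) \<in> smooth_funs A"
    by (intro smooth \<alpha> \<beta> \<kappa>)+
  \<comment> \<open>With a = 2 k \<alpha> + \<kappa>, b = k \<beta> and E = D, formula
    \<open>R\<close> is literally the required one.\<close>
  show ?thesis
    unfolding nearly_quasi_constant_curvature_def
    by (intro conjI assms(1) bexI[OF _ a] bexI[OF _ b] exI[of _ D] D ballI allI)
      (rule R[unfolded G_def K_def])
qed

end
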